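(* $\operatorname{Th}(\mathcal{U})$, the continuous theory of the Urysohn sphere in the language with only the metric, has the tree property of the second kind ($\operatorname{TP}_2$).
   Context: $\mathcal{U}$ is the Urysohn sphere (the unique complete separable metric space of diameter 1 that is ultrahomogeneous and universal for separable metric spaces of diameter $\le1$). A continuous theory $T$ with monster model $\mathbb{M}$ has $\operatorname{TP}_2$ if there are a formula $\varphi(\bar x,\bar y)$, an integer $k>0$ and an array $(\bar a_{i,j})_{i,j<\omega}$ in $\mathbb{M}$ such that (i) for every $\sigma\in\omega^\omega$, $\{\varphi(\bar x,\bar a_{n,\sigma(n)})=0:n<\omega\}$ is satisfiable, and (ii) for every $n<\omega$, $\{\varphi(\bar x,\bar a_{n,i})=0:i<\omega\}$ is $k$-unsatisfiable (every $k$-element subset is unsatisfiable). *)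

theory Defs
  imports "HOL-Analysis.Analysis" "HOL-Library.More_List"
begin

unbundle cardinal_syntax

section \<open>The Urysohn sphere\<close>

definition isometric_embedding :: "'a metric \<Rightarrow> 'b metric \<Rightarrow> ('a \<Rightarrow> 'b) \<Rightarrow> bool" where
  "isometric_embedding X Y f \<longleftrightarrow>
     f ` mspace X \<subseteq> mspace Y \<and>
     (\<forall>x\<in>mspace X. \<forall>y\<in>mspace X. mdist Y (f x) (f y) = mdist X x y)"

definition automorphism :: "'a metric \<Rightarrow> ('a \<Rightarrow> 'a) \<Rightarrow> bool" where
  "automorphism M g \<longleftrightarrow> isometric_embedding M M g \<and> g ` mspace M = mspace M"

definition diameter_le_1 :: "'a metric \<Rightarrow> bool" where
  "diameter_le_1 M \<longleftrightarrow> (\<forall>x\<in>mspace M. \<forall>y\<in>mspace M. mdist M x y \<le> 1)"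

definition diameter_1 :: "'a metric \<Rightarrow> bool" where
  "diameter_1 M \<longleftrightarrow>
     diameter_le_1 M \<and> mspace M \<noteq> {} \<and> (SUP (x, y)\<in>mspace M \<times> mspace M. mdist M x y) = 1"

definition ultrahomogeneous :: "'a metric \<Rightarrow> bool" where
  "ultrahomogeneous M \<longleftrightarrow>
     (\<forall>A f. finite A \<and> A \<subseteq> mspace M \<and> isometric_embedding (submetric M A) M f \<longrightarrow>
        (\<exists>g. automorphism M g \<and> (\<forall>x\<in>A. g x = f x)))"

text \<open>A separable metric space has at most continuum many points, so up to isometry all of them
  have a carrier that is a set of reals; their metrics are arbitrary, unrelated to that of the
  real line.\<close>
definition universal_separable :: "'a metric \<Rightarrow> bool" where
  "universal_separable M \<longleftrightarrow>
     (\<forall>X :: real metric. separable_space (mtopology_of X) \<and> diameter_le_1 X \<longrightarrow>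
        (\<exists>f. isometric_embedding X M f))"

definition urysohn_sphere :: "'a metric \<Rightarrow> bool" where
  "urysohn_sphere U \<longleftrightarrow>
     mcomplete_of U \<and> separable_space (mtopology_of U) \<and> diameter_1 U \<and>
     ultrahomogeneous U \<and> universal_separable U"


section \<open>Continuous logic with the metric as only symbol\<close>

text \<open>In \<open>FConn u \<phi>s\<close> the connective \<open>u\<close> has arity \<open>length \<phi>s\<close>. Tuples of reals of that length
  are represented as sequences continued by zero. Variables are natural numbers.\<close>
datatype form =
    FDist nat nat
  | FConn "(nat \<Rightarrow> real) \<Rightarrow> real" "form list"
  | FSup nat form
  | FInf nat form

definition cube :: "nat \<Rightarrow> (nat \<Rightarrow> real) set" where
  "cube n = {t. (\<forall>i<n. t i \<in> {0..1}) \<and> (\<forall>i\<ge>n. t i = 0)}"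

text \<open>Every continuous function from the cube to the unit interval is admitted as a connective.
  On the cube, the product topology of the function type is the Euclidean one.\<close>
fun wff :: "form \<Rightarrow> bool" where
  "wff (FDist i j) \<longleftrightarrow> True"
| "wff (FConn u \<phi>s) \<longleftrightarrow>
     continuous_on (cube (length \<phi>s)) u \<and> u ` cube (length \<phi>s) \<subseteq> {0..1} \<and> (\<forall>\<phi>\<in>set \<phi>s. wff \<phi>)"
| "wff (FSup i \<phi>) \<longleftrightarrow> wff \<phi>"
| "wff (FInf i \<phi>) \<longleftrightarrow> wff \<phi>"

fun fv :: "form \<Rightarrow> nat set" where
  "fv (FDist i j) = {i, j}"
| "fv (FConn u \<phi>s) = (\<Union>\<phi>\<in>set \<phi>s. fv \<phi>)"
| "fv (FSup i \<phi>) = fv \<phi> - {i}"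
| "fv (FInf i \<phi>) = fv \<phi> - {i}"

fun fval :: "'a metric \<Rightarrow> form \<Rightarrow> (nat \<Rightarrow> 'a) \<Rightarrow> real" where
  "fval M (FDist i j) v = mdist M (v i) (v j)"
| "fval M (FConn u \<phi>s) v = u (nth_default 0 (map (\<lambda>\<phi>. fval M \<phi> v) \<phi>s))"
| "fval M (FSup i \<phi>) v = (SUP a\<in>mspace M. fval M \<phi> (v(i := a)))"
| "fval M (FInf i \<phi>) v = (INF a\<in>mspace M. fval M \<phi> (v(i := a)))"

definition tuples :: "'a set \<Rightarrow> nat \<Rightarrow> 'a list set" where
  "tuples A n = {as. set as \<subseteq> A \<and> length as = n}"

definition formulas :: "nat \<Rightarrow> form set" where
  "formulas n = {\<phi>. wff \<phi> \<and> fv \<phi> \<subseteq> {..<n}}"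

text \<open>Variable \<open>i\<close> is interpreted by the entry \<open>i\<close> of the tuple. This is only used for
  \<open>\<phi> \<in> formulas (length as)\<close>, so that the values of \<open>nth as\<close> beyond the length are irrelevant.\<close>
definition val :: "'a metric \<Rightarrow> form \<Rightarrow> 'a list \<Rightarrow> real" where
  "val M \<phi> as = fval M \<phi> (nth as)"

definition metric_structure :: "'a metric \<Rightarrow> bool" where
  "metric_structure M \<longleftrightarrow> mcomplete_of M \<and> diameter_le_1 M \<and> mspace M \<noteq> {}"

text \<open>A theory is a set of sentences \<open>\<phi>\<close>, each standing for the closed condition \<open>\<phi> = 0\<close>.\<close>
definition Th :: "'a metric \<Rightarrow> form set" where
  "Th M = {\<phi>\<in>formulas 0. val M \<phi> [] = 0}"

definition model :: "form set \<Rightarrow> 'a metric \<Rightarrow> bool" where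
  "model T M \<longleftrightarrow> metric_structure M \<and> (\<forall>\<phi>\<in>T. val M \<phi> [] = 0)"


section \<open>Monster models\<close>

text \<open>An element \<open>(\<phi>, as)\<close> of \<open>conditions A n\<close> is the condition \<open>\<phi>(x, as) = 0\<close> in \<open>n\<close> variables
  with parameters in \<open>A\<close>.\<close>
definition conditions :: "'a set \<Rightarrow> nat \<Rightarrow> (form \<times> 'a list) set" where
  "conditions A n = {(\<phi>, as). set as \<subseteq> A \<and> \<phi> \<in> formulas (n + length as)}"

definition satisfiable_in :: "'a metric \<Rightarrow> nat \<Rightarrow> (form \<times> 'a list) set \<Rightarrow> bool" where
  "satisfiable_in M n \<Gamma> \<longleftrightarrow>
     (\<exists>c\<in>tuples (mspace M) n. \<forall>(\<phi>, as)\<in>\<Gamma>. val M \<phi> (c @ as) = 0)"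

definition saturated :: "'k rel \<Rightarrow> 'a metric \<Rightarrow> bool" where
  "saturated \<kappa> M \<longleftrightarrow>
     (\<forall>A n \<Gamma>. A \<subseteq> mspace M \<and> |A| <o \<kappa> \<and> \<Gamma> \<subseteq> conditions A n \<and>
        (\<forall>\<Gamma>0. finite \<Gamma>0 \<and> \<Gamma>0 \<subseteq> \<Gamma> \<longrightarrow> satisfiable_in M n \<Gamma>0) \<longrightarrow>
        satisfiable_in M n \<Gamma>)"

definition partial_elementary :: "'a metric \<Rightarrow> 'a set \<Rightarrow> ('a \<Rightarrow> 'a) \<Rightarrow> bool" where
  "partial_elementary M A f \<longleftrightarrow>
     f ` A \<subseteq> mspace M \<and>
     (\<forall>n. \<forall>as\<in>tuples A n. \<forall>\<phi>\<in>formulas n. val M \<phi> (map f as) = val M \<phi> as)"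

definition strongly_homogeneous :: "'k rel \<Rightarrow> 'a metric \<Rightarrow> bool" where
  "strongly_homogeneous \<kappa> M \<longleftrightarrow>
     (\<forall>A f. A \<subseteq> mspace M \<and> |A| <o \<kappa> \<and> partial_elementary M A f \<longrightarrow>
        (\<exists>g. automorphism M g \<and> (\<forall>x\<in>A. g x = f x)))"

text \<open>The usual "sufficiently large" cardinal is here any uncountable one: the language is
  countable and only countably many parameters ever occur.\<close>
definition monster_model :: "'k rel \<Rightarrow> form set \<Rightarrow> 'a metric \<Rightarrow> bool" where
  "monster_model \<kappa> T M \<longleftrightarrow>
     Card_order \<kappa> \<and> natLeq <o \<kappa> \<and> model T M \<and> saturated \<kappa> M \<and> strongly_homogeneous \<kappa> M"


section \<open>The tree property of the second kind\<close>

text \<open>The tree property of a theory, evaluated in a monster model \<open>M\<close> of it. The tuples \<open>x\<close> and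
  \<open>y\<close> of \<open>\<phi>(x, y)\<close> consist of the variables below \<open>p\<close> and of the following \<open>q\<close> ones.
  The \<open>k\<close>-element subsets of a row are subsets of its index set, as rows are families: a row of
  equal entries is \<open>k\<close>-unsatisfiable only if its condition is unsatisfiable.\<close>
definition has_TP2 :: "'a metric \<Rightarrow> bool" where
  "has_TP2 M \<longleftrightarrow>
     (\<exists>p q. \<exists>\<phi>\<in>formulas (p + q). \<exists>k>0. \<exists>a :: nat \<Rightarrow> nat \<Rightarrow> 'a list.
        (\<forall>i j. a i j \<in> tuples (mspace M) q) \<and>
        (\<forall>\<sigma> :: nat \<Rightarrow> nat. satisfiable_in M p {(\<phi>, a n (\<sigma> n)) |n. True}) \<and>
        (\<forall>n I. finite I \<and> card I = k \<longrightarrow> \<not> satisfiable_in M p {(\<phi>, a n i) |i. i \<in> I}))"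

end

theory Submission
  imports Defs "HOL-Library.Countable_Set_Type"
begin

text \<open>The formula is \<open>d(x, y) \<le> 1/4\<close>, with \<open>k = 2\<close>. In the array, two entries of the same row have
  distance 1, so no point is within \<open>1/4\<close> of both, and entries of different rows have distance
  \<open>1/2\<close>, so a new point may be put at distance \<open>1/4\<close> from one entry of every row. The array together
  with such points for all finite partial branches is a countable metric space, which embeds into
  \<open>U\<close> by universality. Its points are carried over to \<open>M\<close> one after the other: by
  saturation, a tuple in \<open>M\<close> with the type of a tuple in \<open>U\<close> can be extended in \<open>M\<close> whenever the
  latter is extended in \<open>U\<close>. Finally, saturation turns partial branches into full ones.\<close>

section \<open>Dependence of values on free variables, and their bounds\<close>

lemma fval_cong:
  assumes "\<And>i. i \<in> fv \<phi> \<Longrightarrow> v i = w i"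
  shows "fval M \<phi> v = fval M \<phi> w"
  using assms
proof (induction \<phi> arbitrary: v w)
  case (FConn u \<phi>s)
  have "fval M \<phi> v = fval M \<phi> w" if "\<phi> \<in> set \<phi>s" for \<phi>
    using that FConn.prems by (intro FConn.IH) auto
  then have "map (\<lambda>\<phi>. fval M \<phi> v) \<phi>s = map (\<lambda>\<phi>. fval M \<phi> w) \<phi>s"
    by simp
  then show ?case by (simp only: fval.simps)
next
  case (FSup i \<phi>)
  have "fval M \<phi> (v(i := a)) = fval M \<phi> (w(i := a))" for a
    using FSup.prems by (intro FSup.IH) auto
  then show ?case by simp
next
  case (FInf i \<phi>)
  have "fval M \<phi> (v(i := a)) = fval M \<phi> (w(i := a))" for a
    using FInf.prems by (intro FInf.IH) auto
  then show ?case by simp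
qed auto

lemma nth_default_in_cube:
  assumes "set xs \<subseteq> {0..1}"
  shows "nth_default 0 xs \<in> cube (length xs)"
  using assms by (auto simp: cube_def nth_default_def dest!: nth_mem)

text \<open>The bounds make each \<open>SUP\<close> and \<open>INF\<close> over the carrier
  meaningful in the reals, and they place the arguments of a connective in the cube, where
  \<open>wff\<close> controls it.\<close>

lemma fval_bounds:
  assumes M: "diameter_le_1 M" "mspace M \<noteq> {}"
    and "wff \<phi>" "v ` fv \<phi> \<subseteq> mspace M"
  shows "fval M \<phi> v \<in> {0..1}"
  using assms(3,4)
proof (induction \<phi> arbitrary: v)
  case (FDist i j)
  then show ?case using M by (auto simp: diameter_le_1_def)
next
  case (FConn u \<phi>s)
  have "fval M \<phi> v \<in> {0..1}" if "\<phi> \<in> set \<phi>s" for \<phi>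
    using FConn.prems that by (intro FConn.IH) auto
  then have "nth_default 0 (map (\<lambda>\<phi>. fval M \<phi> v) \<phi>s) \<in> cube (length \<phi>s)"
    using nth_default_in_cube[of "map (\<lambda>\<phi>. fval M \<phi> v) \<phi>s"] by (auto simp: image_subset_iff)
  then show ?case using FConn.prems(1) by auto
next
  case (FSup i \<phi>)
  have *: "fval M \<phi> (v(i := a)) \<in> {0..1}" if "a \<in> mspace M" for a
    using FSup.prems that by (intro FSup.IH) auto
  obtain a where a: "a \<in> mspace M" using M by blast
  have "fval M \<phi> (v(i := a)) \<le> (SUP a\<in>mspace M. fval M \<phi> (v(i := a)))"
    using * a by (intro cSUP_upper bdd_aboveI2[where M = 1]) auto
  moreover have "(SUP a\<in>mspace M. fval M \<phi> (v(i := a))) \<le> 1"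
    using * M by (intro cSUP_least) auto
  ultimately show ?case using *[OF a] by auto
next
  case (FInf i \<phi>)
  have *: "fval M \<phi> (v(i := a)) \<in> {0..1}" if "a \<in> mspace M" for a
    using FInf.prems that by (intro FInf.IH) auto
  obtain a where a: "a \<in> mspace M" using M by blast
  have "(INF a\<in>mspace M. fval M \<phi> (v(i := a))) \<le> fval M \<phi> (v(i := a))"
    using * a by (intro cINF_lower bdd_belowI2[where m = 0]) auto
  moreover have "0 \<le> (INF a\<in>mspace M. fval M \<phi> (v(i := a)))"
    using * M by (intro cINF_greatest) auto
  ultimately show ?case using *[OF a] by auto
qed

lemma val_bounds:
  assumes "diameter_le_1 M" "mspace M \<noteq> {}" "\<phi> \<in> formulas (length as)" "set as \<subseteq> mspace M"
  shows "val M \<phi> as \<in> {0..1}"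
  unfolding val_def using assms
  by (intro fval_bounds) (auto simp: formulas_def subset_iff)

section \<open>Injective renaming of variables\<close>

fun rename :: "(nat \<Rightarrow> nat) \<Rightarrow> form \<Rightarrow> form" where
  "rename f (FDist i j) = FDist (f i) (f j)"
| "rename f (FConn u \<phi>s) = FConn u (map (rename f) \<phi>s)"
| "rename f (FSup i \<phi>) = FSup (f i) (rename f \<phi>)"
| "rename f (FInf i \<phi>) = FInf (f i) (rename f \<phi>)"

lemma wff_rename [simp]: "wff (rename f \<phi>) \<longleftrightarrow> wff \<phi>"
  by (induction \<phi>) auto

lemma fv_rename:
  assumes "inj f"
  shows "fv (rename f \<phi>) = f ` fv \<phi>"
  by (induction \<phi>) (auto simp: image_UN image_set_diff[OF assms])

text \<open>By injectivity, an update at the renamed bound variable \<open>f i\<close> affects no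
  variable other than \<open>i\<close> after composition with \<open>f\<close>, so nothing is
  captured.\<close>

lemma fval_rename:
  assumes "inj f"
  shows "fval M (rename f \<phi>) v = fval M \<phi> (v \<circ> f)"
proof (induction \<phi> arbitrary: v)
  case (FConn u \<phi>s)
  have "map ((\<lambda>\<phi>. fval M \<phi> v) \<circ> rename f) \<phi>s = map (\<lambda>\<phi>. fval M \<phi> (v \<circ> f)) \<phi>s"
    using FConn.IH by (simp add: comp_def)
  then show ?case by (simp only: rename.simps fval.simps map_map)
next
  case (FSup i \<phi>)
  have "v(f i := a) \<circ> f = (v \<circ> f)(i := a)" for a
    using assms by (auto simp: fun_eq_iff inj_eq)
  then show ?case by (simp only: rename.simps fval.simps FSup.IH)
next
  case (FInf i \<phi>)
  have "v(f i := a) \<circ> f = (v \<circ> f)(i := a)" for a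
    using assms by (auto simp: fun_eq_iff inj_eq)
  then show ?case by (simp only: rename.simps fval.simps FInf.IH)
qed auto

section \<open>Connectives that relax and combine conditions\<close>

text \<open>The truncated subtraction \<open>\<phi> - \<epsilon>\<close>, which turns the condition \<open>\<phi> \<le> \<epsilon>\<close> into one of the
  form \<open>\<psi> = 0\<close>.\<close>
definition monus :: "form \<Rightarrow> real \<Rightarrow> form" where
  "monus \<phi> \<epsilon> = FConn (\<lambda>t. max 0 (t 0 - \<epsilon>)) [\<phi>]"

definition deviation :: "form \<Rightarrow> real \<Rightarrow> form" where
  "deviation \<phi> r = FConn (\<lambda>t. \<bar>t 0 - r\<bar>) [\<phi>]"

text \<open>Values are nonnegative, so this merges finitely many zero conditions into one. The
  truncation at 1 keeps the connective admissible.\<close>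

definition bounded_sum :: "form list \<Rightarrow> form" where
  "bounded_sum \<phi>s = FConn (\<lambda>t. min 1 (\<Sum>i<length \<phi>s. t i)) \<phi>s"

lemma continuous_on_apply:
  "continuous_on S (\<lambda>t :: 'i \<Rightarrow> 'b :: topological_space. t i)"
  by (rule continuous_on_subset[OF continuous_on_product_coordinates]) simp

lemma formulas_monus: "\<epsilon> \<ge> 0 \<Longrightarrow> \<phi> \<in> formulas n \<Longrightarrow> monus \<phi> \<epsilon> \<in> formulas n"
  by (auto simp: formulas_def monus_def cube_def
      intro!: continuous_on_max continuous_on_diff continuous_on_const continuous_on_apply)

lemma formulas_deviation: "r \<in> {0..1} \<Longrightarrow> \<phi> \<in> formulas n \<Longrightarrow> deviation \<phi> r \<in> formulas n"
  by (auto simp: formulas_def deviation_def cube_def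
      intro!: continuous_on_rabs continuous_on_diff continuous_on_const continuous_on_apply)

lemma formulas_bounded_sum: "set \<phi>s \<subseteq> formulas n \<Longrightarrow> bounded_sum \<phi>s \<in> formulas n"
  by (auto simp: formulas_def bounded_sum_def cube_def
      intro!: continuous_on_min continuous_on_sum continuous_on_const continuous_on_apply sum_nonneg)

lemma val_monus: "val M (monus \<phi> \<epsilon>) as = max 0 (val M \<phi> as - \<epsilon>)"
  by (simp add: val_def monus_def nth_default_def)

lemma val_deviation: "val M (deviation \<phi> r) as = \<bar>val M \<phi> as - r\<bar>"
  by (simp add: val_def deviation_def nth_default_def)

lemma val_bounded_sum: "val M (bounded_sum \<phi>s) as = min 1 (\<Sum>\<phi>\<leftarrow>\<phi>s. val M \<phi> as)"
  by (simp add: val_def bounded_sum_def nth_default_def sum_list_sum_nth atLeast0LessThan)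

section \<open>Elimination of a variable by an infimum\<close>

text \<open>Saturation realises types in the variable 0, with the parameters behind it. Eliminating
  this variable by an infimum leaves a formula in \<open>{1..n}\<close>, which has to be renumbered by an
  injective function: bound variables are renamed as well.\<close>
definition rotate_vars :: "nat \<Rightarrow> nat \<Rightarrow> nat" where
  "rotate_vars n i = (if i = 0 then n else if i \<le> n then i - 1 else i)"

definition project :: "nat \<Rightarrow> form \<Rightarrow> form" where
  "project n \<phi> = rename (rotate_vars n) (FInf 0 \<phi>)"

lemma inj_rotate_vars: "inj (rotate_vars n)"
  by (auto simp: inj_def rotate_vars_def split: if_splits)

lemma formulas_project:
  assumes "\<phi> \<in> formulas (Suc n)"
  shows "project n \<phi> \<in> formulas n"
proof -
  have "rotate_vars n ` (fv \<phi> - {0}) \<subseteq> {..<n}"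
    using assms by (auto simp: formulas_def rotate_vars_def)
  then show ?thesis
    using assms fv_rename[OF inj_rotate_vars, of n "FInf 0 \<phi>"]
    by (auto simp: formulas_def project_def)
qed

lemma val_project:
  assumes "\<phi> \<in> formulas (Suc (length as))"
  shows "val M (project (length as) \<phi>) as = (INF c\<in>mspace M. val M \<phi> (c # as))"
proof -
  \<comment> \<open>Variable 0 takes the value of the bound variable, and a free variable
    \<open>i > 0\<close> reads entry \<open>i - 1\<close> of \<open>as\<close>. Beyond
    \<open>length as\<close> the two assignments may differ, but no variable there is free in
    \<open>\<phi>\<close>.\<close>
  have "fval M \<phi> ((nth as \<circ> rotate_vars (length as))(0 := c)) = fval M \<phi> (nth (c # as))" for c
    using assms
    by (intro fval_cong) (auto simp: formulas_def rotate_vars_def nth_Cons split: nat.splits)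
  then show ?thesis
    unfolding project_def val_def fval_rename[OF inj_rotate_vars] by simp
qed

section \<open>Extension of tuples of the same type\<close>

text \<open>Since \<open>\<phi> = r\<close> is the condition \<open>deviation \<phi> r = 0\<close>, one implication between zero conditions
  already makes all values agree.\<close>
definition same_type :: "'a metric \<Rightarrow> 'a list \<Rightarrow> 'b metric \<Rightarrow> 'b list \<Rightarrow> bool" where
  "same_type U bs M as \<longleftrightarrow>
     length as = length bs \<and> set bs \<subseteq> mspace U \<and> set as \<subseteq> mspace M \<and>
     (\<forall>\<phi>\<in>formulas (length bs). val U \<phi> bs = 0 \<longrightarrow> val M \<phi> as = 0)"

lemma same_type_mdist:
  assumes "same_type U bs M as" "diameter_le_1 U" "i < length bs" "j < length bs"
  shows "mdist M (as ! i) (as ! j) = mdist U (bs ! i) (bs ! j)"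
proof -
  let ?r = "mdist U (bs ! i) (bs ! j)"
  have "?r \<in> {0..1}"
    using assms by (auto simp: same_type_def diameter_le_1_def subset_iff)
  moreover have "FDist i j \<in> formulas (length bs)"
    using assms by (simp add: formulas_def)
  ultimately have "deviation (FDist i j) ?r \<in> formulas (length bs)"
    by (rule formulas_deviation)
  moreover have "val U (deviation (FDist i j) ?r) bs = 0"
    by (simp add: val_deviation) (simp add: val_def)
  ultimately have "val M (deviation (FDist i j) ?r) as = 0"
    using assms(1) by (auto simp: same_type_def)
  then show ?thesis
    by (simp add: val_deviation) (simp add: val_def)
qed

text \<open>That the sum of \<open>\<Phi>\<close> has infimum 0 over the new variable is a zero
  condition on \<open>bs\<close>, witnessed by \<open>b\<close>, so it passes to \<open>as\<close>.
  The infimum in \<open>M\<close> need not be attained, which leaves an error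
  \<open>\<epsilon>\<close>.\<close>

lemma same_type_approx_extend:
  assumes st: "same_type U bs M as" and b: "b \<in> mspace U"
    and U: "diameter_le_1 U" and M: "diameter_le_1 M" "mspace M \<noteq> {}"
    and \<Phi>: "finite \<Phi>" "\<Phi> \<subseteq> formulas (Suc (length bs))" "\<And>\<phi>. \<phi> \<in> \<Phi> \<Longrightarrow> val U \<phi> (b # bs) = 0"
    and "\<epsilon> > 0"
  shows "\<exists>c\<in>mspace M. \<forall>\<phi>\<in>\<Phi>. val M \<phi> (c # as) < \<epsilon>"
proof -
  have len: "length as = length bs" and bs: "set bs \<subseteq> mspace U" and as: "set as \<subseteq> mspace M"
    using st by (auto simp: same_type_def)
  obtain \<phi>s where \<phi>s: "set \<phi>s = \<Phi>"
    using \<Phi>(1) finite_list by blast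
  define \<psi> where "\<psi> = bounded_sum \<phi>s"
  have \<psi>: "\<psi> \<in> formulas (Suc (length bs))"
    unfolding \<psi>_def using \<Phi> \<phi>s by (intro formulas_bounded_sum) auto
  have nonneg: "0 \<le> val U \<psi> (c # bs)" if "c \<in> mspace U" for c
    using val_bounds[of U \<psi> "c # bs"] U bs \<psi> that by auto
  have "map (\<lambda>\<phi>. val U \<phi> (b # bs)) \<phi>s = map (\<lambda>\<phi>. 0) \<phi>s"
    using \<Phi>(3) \<phi>s by simp
  then have "(\<Sum>\<phi>\<leftarrow>\<phi>s. val U \<phi> (b # bs)) = 0"
    by (simp only: sum_list_0)
  then have "val U \<psi> (b # bs) = 0"
    unfolding \<psi>_def val_bounded_sum by simp
  then have "(INF c\<in>mspace U. val U \<psi> (c # bs)) \<le> 0"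
    using nonneg b by (intro cINF_lower2[of _ _ b] bdd_belowI2[where m = 0]) auto
  moreover have "0 \<le> (INF c\<in>mspace U. val U \<psi> (c # bs))"
    using nonneg b by (intro cINF_greatest) auto
  ultimately have "val U (project (length bs) \<psi>) bs = 0"
    using val_project[OF \<psi>] by simp
  then have "val M (project (length bs) \<psi>) as = 0"
    using st formulas_project[OF \<psi>] by (simp add: same_type_def)
  then have "(INF c\<in>mspace M. val M \<psi> (c # as)) = 0"
    using val_project[of \<psi> as] \<psi> len by simp
  \<comment> \<open>A value of \<open>bounded_sum\<close> below 1 is the sum itself, which then
    bounds every summand.\<close>
  then have "(INF c\<in>mspace M. val M \<psi> (c # as)) < min 1 \<epsilon>"
    using \<open>\<epsilon> > 0\<close> by simp
  moreover have "0 \<le> val M \<psi> (c # as)" if "c \<in> mspace M" for c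
    using val_bounds[of M \<psi> "c # as"] M as \<psi> len that by auto
  then have "bdd_below ((\<lambda>c. val M \<psi> (c # as)) ` mspace M)"
    by (rule bdd_belowI2)
  ultimately obtain c where c: "c \<in> mspace M" "val M \<psi> (c # as) < min 1 \<epsilon>"
    using cINF_less_iff[OF M(2)] by blast
  have "val M \<phi> (c # as) < \<epsilon>" if "\<phi> \<in> \<Phi>" for \<phi>
  proof -
    have "0 \<le> val M \<theta> (c # as)" if "\<theta> \<in> set \<phi>s" for \<theta>
      using val_bounds[of M \<theta> "c # as"] M as c(1) \<Phi>(2) \<phi>s len that by auto
    then have "val M \<phi> (c # as) \<le> (\<Sum>\<phi>\<leftarrow>\<phi>s. val M \<phi> (c # as))"
      using that \<phi>s by (intro member_le_sum_list) auto
    then show ?thesis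
      using c(2) unfolding \<psi>_def val_bounded_sum by linarith
  qed
  then show ?thesis using c(1) by blast
qed

lemma saturatedD:
  assumes "saturated \<kappa> M" "A \<subseteq> mspace M" "|A| <o \<kappa>" "\<Gamma> \<subseteq> conditions A n"
    and "\<And>\<Gamma>0. finite \<Gamma>0 \<Longrightarrow> \<Gamma>0 \<subseteq> \<Gamma> \<Longrightarrow> satisfiable_in M n \<Gamma>0"
  shows "satisfiable_in M n \<Gamma>"
  using assms(1)[unfolded saturated_def, rule_format, of A \<Gamma> n] assms(2-5) by simp

text \<open>Saturation turns the approximate solutions for finitely many formulas into one exact
  solution for all of them.\<close>

lemma same_type_extend:
  assumes st: "same_type U bs M as" and b: "b \<in> mspace U"
    and U: "diameter_le_1 U" and M: "diameter_le_1 M" "mspace M \<noteq> {}"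
    and sat: "saturated \<kappa> M" "|set as| <o \<kappa>"
  shows "\<exists>c. same_type U (b # bs) M (c # as)"
proof -
  have len: "length as = length bs" and bs: "set bs \<subseteq> mspace U" and as: "set as \<subseteq> mspace M"
    using st by (auto simp: same_type_def)
  define T where "T = {\<phi> \<in> formulas (Suc (length bs)). val U \<phi> (b # bs) = 0}"
  \<comment> \<open>Finite satisfiability in \<open>M\<close> is available only up to an error, so
    each \<open>\<phi> = 0\<close> is replaced by the conditions
    \<open>\<phi> \<le> \<epsilon>\<close> for all positive \<open>\<epsilon>\<close>.\<close>
  define \<Gamma> where "\<Gamma> = (\<lambda>(\<phi>, \<epsilon>). (monus \<phi> \<epsilon>, as)) ` (T \<times> {0<..})"
  have "satisfiable_in M 1 \<Gamma>0" if "finite \<Gamma>0" "\<Gamma>0 \<subseteq> \<Gamma>" for \<Gamma>0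
  proof -
    obtain P where P: "P \<subseteq> T \<times> {0<..}" "finite P" "\<Gamma>0 = (\<lambda>(\<phi>, \<epsilon>). (monus \<phi> \<epsilon>, as)) ` P"
      using \<open>finite \<Gamma>0\<close> \<open>\<Gamma>0 \<subseteq> \<Gamma>\<close> unfolding \<Gamma>_def by (meson finite_subset_image)
    \<comment> \<open>The extra 1 covers an empty \<open>P\<close>.\<close>
    define \<epsilon> where "\<epsilon> = Min (insert 1 (snd ` P))"
    have "\<epsilon> > 0"
      using P by (auto simp: \<epsilon>_def)
    have "fst ` P \<subseteq> T"
      using P by auto
    then obtain c where c: "c \<in> mspace M" "\<And>\<phi>. \<phi> \<in> fst ` P \<Longrightarrow> val M \<phi> (c # as) < \<epsilon>"
      using same_type_approx_extend[OF st b U M, of "fst ` P" \<epsilon>] P(2) \<open>\<epsilon> > 0\<close>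
      unfolding T_def by blast
    have "val M (monus \<phi> \<delta>) (c # as) = 0" if "(\<phi>, \<delta>) \<in> P" for \<phi> \<delta>
    proof -
      have "\<phi> \<in> fst ` P" "\<delta> \<in> insert 1 (snd ` P)"
        using image_eqI[OF _ that, of \<phi> fst] image_eqI[OF _ that, of \<delta> snd] by simp_all
      then have "val M \<phi> (c # as) < \<epsilon>" "\<epsilon> \<le> \<delta>"
        using c(2) P(2) by (simp_all add: \<epsilon>_def)
      then show ?thesis by (simp add: val_monus)
    qed
    then show ?thesis
      unfolding satisfiable_in_def P(3) using c(1)
      by (intro bexI[of _ "[c]"]) (auto simp: tuples_def)
  qed
  moreover have "\<Gamma> \<subseteq> conditions (set as) 1"
    using formulas_monus len by (auto simp: \<Gamma>_def conditions_def T_def)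
  ultimately have "satisfiable_in M 1 \<Gamma>"
    by (rule saturatedD[OF sat(1) as sat(2), rotated])
  then obtain cs where cs: "cs \<in> tuples (mspace M) 1" "\<forall>(\<phi>, as)\<in>\<Gamma>. val M \<phi> (cs @ as) = 0"
    unfolding satisfiable_in_def by blast
  then obtain c where "cs = [c]" "c \<in> mspace M"
    by (auto simp: tuples_def length_Suc_conv)
  then have c: "c \<in> mspace M" "\<And>\<phi> \<epsilon>. \<phi> \<in> T \<Longrightarrow> \<epsilon> > 0 \<Longrightarrow> val M (monus \<phi> \<epsilon>) (c # as) = 0"
    using cs(2) by (auto simp: \<Gamma>_def)
  have "val M \<phi> (c # as) = 0" if "\<phi> \<in> T" for \<phi>
  proof (rule antisym)
    show "val M \<phi> (c # as) \<le> 0"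
    proof (rule field_le_epsilon)
      fix \<epsilon> :: real assume "\<epsilon> > 0"
      then have "max 0 (val M \<phi> (c # as) - \<epsilon>) = 0"
        using c(2)[OF that] by (simp add: val_monus)
      then show "val M \<phi> (c # as) \<le> 0 + \<epsilon>"
        by linarith
    qed
    show "0 \<le> val M \<phi> (c # as)"
      using val_bounds[of M \<phi> "c # as"] M as c(1) that len by (auto simp: T_def)
  qed
  then show ?thesis
    using len bs as b c(1) by (auto simp: same_type_def T_def)
qed

section \<open>Isometric copies of countable spaces in the monster model\<close>

text \<open>The points are carried over one at a time, so that only finitely many parameters occur
  at each stage. New points go to the front of the tuple, which is why the lists are
  reversed.\<close>

lemma isometric_sequence_in_saturated_model:
  fixes b :: "nat \<Rightarrow> 'a" and M :: "'m metric"
  assumes \<kappa>: "natLeq <o \<kappa>" and M: "model (Th U) M" and sat: "saturated \<kappa> M"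
    and U: "diameter_le_1 U" and b: "range b \<subseteq> mspace U"
  shows "\<exists>a. range a \<subseteq> mspace M \<and> (\<forall>i j. mdist M (a i) (a j) = mdist U (b i) (b j))"
proof -
  let ?bs = "\<lambda>n. map b (rev [0..<n])"
  have M': "diameter_le_1 M" "mspace M \<noteq> {}"
    using M by (auto simp: model_def metric_structure_def)
  have small: "|set xs| <o \<kappa>" for xs :: "'m list"
    using \<kappa> finite_iff_ordLess_natLeq[of "set xs"] ordLess_transitive by auto
  have "\<exists>f. \<forall>n. same_type U (?bs n) M (f n) \<and> (\<exists>c. f (Suc n) = c # f n)"
  proof (rule dependent_nat_choice)
    show "\<exists>as. same_type U (?bs 0) M as"
      \<comment> \<open>For empty tuples, having the same type means that \<open>M\<close> satisfies
        \<open>Th U\<close>.\<close>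
      using M by (auto simp: same_type_def model_def Th_def)
  next
    fix as n assume "same_type U (?bs n) M as"
    then obtain c where "same_type U (b n # ?bs n) M (c # as)"
      using same_type_extend[OF _ _ U M' sat small] b by blast
    then show "\<exists>as'. same_type U (?bs (Suc n)) M as' \<and> (\<exists>c. as' = c # as)"
      by auto
  qed
  then obtain f where f: "\<And>n. same_type U (?bs n) M (f n)" "\<And>n. \<exists>c. f (Suc n) = c # f n"
    by blast
  define a where "a k = hd (f (Suc k))" for k
  have f_eq: "f n = map a (rev [0..<n])" for n
  proof (induction n)
    case 0
    then show ?case using f(1)[of 0] by (simp add: same_type_def)
  next
    case (Suc n)
    then show ?case using f(2)[of n] by (auto simp: a_def)
  qed
  have "a k \<in> mspace M" for k
    using f(1)[of "Suc k"] unfolding f_eq by (simp add: same_type_def)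
  moreover have "mdist M (a i) (a j) = mdist U (b i) (b j)" for i j
  proof -
    define n where "n = Suc (max i j)"
    have "i < n" "j < n"
      by (auto simp: n_def)
    then show ?thesis
      \<comment> \<open>In the reversed list of length \<open>n\<close>, the point with index
        \<open>i\<close> stands at position \<open>n - Suc i\<close>.\<close>
      using same_type_mdist[OF f(1)[of n] U, of "n - Suc i" "n - Suc j"]
      unfolding f_eq by (simp add: rev_nth)
  qed
  ultimately show ?thesis by blast
qed

text \<open>Universality is stated for carriers of reals only, so the metric of \<open>X\<close> is
  first transported along an injection into the natural numbers, read as reals.\<close>

lemma isometric_embedding_countable_urysohn:
  fixes X :: "'b metric"
  assumes U: "urysohn_sphere U" and X: "countable (mspace X)" "diameter_le_1 X"
  shows "\<exists>f. isometric_embedding X U f"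
proof -
  define g where "g x = real (to_nat_on (mspace X) x)" for x
  define h where "h = inv_into (mspace X) g"
  have hg: "h (g x) = x" if "x \<in> mspace X" for x
    unfolding h_def using inj_on_to_nat_on[OF X(1)] that
    by (intro inv_into_f_f) (auto simp: g_def inj_on_def)
  interpret R: Metric_space "g ` mspace X" "\<lambda>x y. mdist X (h x) (h y)"
    by unfold_locales (auto simp: hg mdist_commute mdist_triangle)
  define R where "R = metric (g ` mspace X, \<lambda>x y. mdist X (h x) (h y))"
  have R: "mspace R = g ` mspace X" "mdist R = (\<lambda>x y. mdist X (h x) (h y))"
    by (simp_all add: R_def)
  have "separable_space (mtopology_of R)"
    unfolding separable_space_def
    using X(1) closure_of_topspace[of "mtopology_of R"] unfolding topspace_mtopology_of R
    by (intro exI[of _ "g ` mspace X"]) simp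
  moreover have "diameter_le_1 R"
    using X(2) by (auto simp: diameter_le_1_def R hg)
  ultimately obtain f where "isometric_embedding R U f"
    using U unfolding urysohn_sphere_def universal_separable_def by blast
  then have "isometric_embedding X U (f \<circ> g)"
    by (auto simp: isometric_embedding_def R hg image_subset_iff)
  then show ?thesis by blast
qed

text \<open>An enumeration turns the copy of \<open>X\<close> in \<open>U\<close> into a sequence.
  It repeats points if \<open>X\<close> is finite, which is harmless.\<close>

lemma isometric_embedding_countable_monster:
  fixes X :: "'b metric"
  assumes U: "urysohn_sphere U" and M: "monster_model \<kappa> (Th U) M"
    and X: "countable (mspace X)" "diameter_le_1 X"
  shows "\<exists>f. isometric_embedding X M f"
proof (cases "mspace X = {}")
  case True
  then show ?thesis by (simp add: isometric_embedding_def)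
next
  case False
  obtain f where f: "isometric_embedding X U f"
    using isometric_embedding_countable_urysohn[OF U X] by blast
  define e where "e = from_nat_into (mspace X)"
  have "range (f \<circ> e) \<subseteq> mspace U"
    using f from_nat_into[OF False] by (auto simp: isometric_embedding_def e_def image_subset_iff)
  moreover have "diameter_le_1 U"
    using U by (simp add: urysohn_sphere_def diameter_1_def)
  ultimately obtain a where a: "range a \<subseteq> mspace M"
      "\<And>i j. mdist M (a i) (a j) = mdist U ((f \<circ> e) i) ((f \<circ> e) j)"
    using isometric_sequence_in_saturated_model[of \<kappa> U M "f \<circ> e"] M
    unfolding monster_model_def by blast
  have "isometric_embedding X M (a \<circ> to_nat_on (mspace X))"
    using a f X(1) by (auto simp: isometric_embedding_def e_def)
  then show ?thesis by blast
qed

section \<open>The array and its partial branches\<close>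

text \<open>The left summand holds the entries of the array, the right one realisations of the finite
  initial segments of the branches.\<close>
fun pattern_dist :: "nat \<times> nat + nat list \<Rightarrow> nat \<times> nat + nat list \<Rightarrow> real" where
  "pattern_dist (Inl (m, i)) (Inl (n, j)) = (if m \<noteq> n then 1/2 else if i \<noteq> j then 1 else 0)"
| "pattern_dist (Inl (m, i)) (Inr t) = (if m < length t \<and> t ! m = i then 1/4 else 3/4)"
| "pattern_dist (Inr s) (Inl (n, j)) = (if n < length s \<and> s ! n = j then 1/4 else 3/4)"
| "pattern_dist (Inr s) (Inr t) = (if s = t then 0 else 1/2)"

text \<open>Nonzero distances are at least 1/2 within a summand and at least 1/4 across. The
  critical case is two entries of one row, at distance 1: a list \<open>t\<close> has only one value
  \<open>t ! m\<close>, so it cannot be at 1/4 from both.\<close>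

lemma Metric_space_pattern: "Metric_space UNIV pattern_dist"
proof
  fix x y z
  show "0 \<le> pattern_dist x y"
    by (cases "(x, y)" rule: pattern_dist.cases) auto
  show "pattern_dist x y = pattern_dist y x"
    by (cases "(x, y)" rule: pattern_dist.cases) auto
  show "pattern_dist x y = 0 \<longleftrightarrow> x = y"
    by (cases "(x, y)" rule: pattern_dist.cases) auto
  show "pattern_dist x z \<le> pattern_dist x y + pattern_dist y z"
    by (cases "(x, y)" rule: pattern_dist.cases; cases z) auto
qed

theorem theorem3p10:
  fixes U :: "'a metric" and M :: "'m metric" and \<kappa> :: "'k rel"
  assumes "urysohn_sphere U"
    and "monster_model \<kappa> (Th U) M"
  shows "has_TP2 M"
proof -
  interpret P: Metric_space UNIV pattern_dist
    by (rule Metric_space_pattern)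
  define P where "P = metric (UNIV, pattern_dist)"
  have P: "mspace P = UNIV" "mdist P = pattern_dist"
    by (simp_all add: P_def)
  have "pattern_dist x y \<le> 1" for x y
    by (cases "(x, y)" rule: pattern_dist.cases) auto
  then have "diameter_le_1 P"
    by (simp add: diameter_le_1_def P)
  then obtain f where f: "\<And>x. f x \<in> mspace M" "\<And>x y. mdist M (f x) (f y) = pattern_dist x y"
    using isometric_embedding_countable_monster[OF assms, of P]
    by (auto simp: isometric_embedding_def P)
  define a where "a n i = [f (Inl (n, i))]" for n i :: nat
  define \<phi> where "\<phi> = monus (FDist 0 1) (1/4)"
  have \<phi>: "\<phi> \<in> formulas (1 + 1)"
    unfolding \<phi>_def by (intro formulas_monus) (auto simp: formulas_def)
  have val_\<phi>: "val M \<phi> [c, d] = 0 \<longleftrightarrow> mdist M c d \<le> 1/4" for c d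
    unfolding \<phi>_def val_monus by (simp add: val_def max_def)
  have sat_iff: "satisfiable_in M 1 ((\<lambda>d. (\<phi>, [d])) ` D) \<longleftrightarrow> (\<exists>c\<in>mspace M. \<forall>d\<in>D. mdist M c d \<le> 1/4)"
    for D
  proof -
    have "tuples (mspace M) 1 = (\<lambda>c. [c]) ` mspace M"
      by (auto simp: tuples_def length_Suc_conv)
    then show ?thesis
      by (simp add: satisfiable_in_def val_\<phi>)
  qed
  have rows: "\<not> satisfiable_in M 1 {(\<phi>, a n i) |i. i \<in> I}" if "finite I" "card I = 2" for n I
  proof
    obtain i j where I: "I = {i, j}" "i \<noteq> j"
      using \<open>card I = 2\<close> by (auto simp: card_2_iff)
    have "{(\<phi>, a n i) |i. i \<in> I} = (\<lambda>d. (\<phi>, [d])) ` (\<lambda>i. f (Inl (n, i))) ` I"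
      by (auto simp: a_def)
    moreover assume "satisfiable_in M 1 {(\<phi>, a n i) |i. i \<in> I}"
    ultimately have "\<exists>c\<in>mspace M. \<forall>d\<in>(\<lambda>i. f (Inl (n, i))) ` I. mdist M c d \<le> 1/4"
      by (simp only: sat_iff)
    then obtain c where c: "c \<in> mspace M"
        "mdist M c (f (Inl (n, i))) \<le> 1/4" "mdist M c (f (Inl (n, j))) \<le> 1/4"
      using I(1) by blast
    \<comment> \<open>The left side is 1, the right side at most 1/2.\<close>
    have "mdist M (f (Inl (n, i))) (f (Inl (n, j))) \<le>
        mdist M (f (Inl (n, i))) c + mdist M c (f (Inl (n, j)))"
      by (rule mdist_triangle[OF f(1) c(1) f(1)])
    then show False
      using c I(2) by (simp add: f(2) mdist_commute)
  qed
  have branches: "satisfiable_in M 1 {(\<phi>, a n (\<sigma> n)) |n. True}" for \<sigma>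
  proof -
    define D where "D = range (\<lambda>n. f (Inl (n, \<sigma> n)))"
    define \<Gamma> where "\<Gamma> = (\<lambda>d. (\<phi>, [d])) ` D"
    have "satisfiable_in M 1 \<Gamma>0" if fin: "finite \<Gamma>0" and sub: "\<Gamma>0 \<subseteq> \<Gamma>" for \<Gamma>0
    proof -
      obtain N where N: "finite N" "\<Gamma>0 = (\<lambda>d. (\<phi>, [d])) ` (\<lambda>n. f (Inl (n, \<sigma> n))) ` N"
        using finite_subset_image[OF fin, of "\<lambda>n. (\<phi>, [f (Inl (n, \<sigma> n))])" UNIV] sub
        unfolding \<Gamma>_def D_def image_image by blast
      \<comment> \<open>The initial segment of \<open>\<sigma>\<close> that includes position
        \<open>Max N\<close> realises all rows in \<open>N\<close>. For empty \<open>N\<close> any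
        list would do.\<close>
      define s where "s = map \<sigma> [0..<Suc (Max N)]"
      have "mdist M (f (Inr s)) (f (Inl (n, \<sigma> n))) \<le> 1/4" if "n \<in> N" for n
      proof -
        have "n < Suc (Max N)"
          using N(1) that by (simp add: less_Suc_eq_le)
        then show ?thesis by (simp add: f(2) s_def del: upt_Suc)
      qed
      then show ?thesis
        unfolding N(2) sat_iff using f(1) by blast
    qed
    moreover have "\<Gamma> \<subseteq> conditions D 1"
      using \<phi> by (auto simp: \<Gamma>_def conditions_def)
    moreover have "D \<subseteq> mspace M"
      using f(1) by (auto simp: D_def)
    \<comment> \<open>A branch has countably many parameters, and \<open>\<kappa>\<close> is
      uncountable.\<close>
    moreover have "|D| <o \<kappa>"
    proof (rule ordLeq_ordLess_trans)
      show "|D| \<le>o natLeq"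
        by (simp add: D_def flip: countable_card_le_natLeq)
      show "natLeq <o \<kappa>"
        using assms(2) by (simp add: monster_model_def)
    qed
    moreover have "saturated \<kappa> M"
      using assms(2) by (simp add: monster_model_def)
    ultimately have "satisfiable_in M 1 \<Gamma>"
      by (simp add: saturatedD)
    moreover have "\<Gamma> = {(\<phi>, a n (\<sigma> n)) |n. True}"
      by (auto simp: \<Gamma>_def D_def a_def)
    ultimately show ?thesis by simp
  qed
  show ?thesis
    unfolding has_TP2_def using \<phi> rows branches f(1)
    by (intro exI[of _ 1] bexI[of _ \<phi>] exI[of _ 2] conjI exI[of _ a]) (auto simp: tuples_def a_def)
qed

end
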